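(* Let $a,b$ be nonzero real numbers. For every integer $n\ge 0$, $$\mathcal{F}_n(a,b)=\begin{pmatrix}\left(\frac{b}{a}\right)^{\varepsilon(n)}q_{n+1} & \frac{b}{a}\,q_n\\ q_n & \left(\frac{b}{a}\right)^{\varepsilon(n)}q_{n-1}\end{pmatrix}.$$
   Context: Fix nonzero real numbers $a,b$. The bi-periodic Fibonacci sequence $(q_n)_{n\ge 0}$ is defined by $q_0=0$, $q_1=1$, and for $n\ge 2$: $q_n=a q_{n-1}+q_{n-2}$ if $n$ is even, $q_n=b q_{n-1}+q_{n-2}$ if $n$ is odd. By extending the recurrence to $n=1$ one sets $q_{-1}=1$. The bi-periodic Fibonacci matrix sequence $(\mathcal{F}_n(a,b))_{n\ge 0}$ of $2\times 2$ real matrices is defined by $\mathcal{F}_0(a,b)=\begin{pmatrix}1&0\\0&1\end{pmatrix}$, $\mathcal{F}_1(a,b)=\begin{pmatrix}b&\frac{b}{a}\\1&0\end{pmatrix}$, and for $n\ge 2$: $\mathcal{F}_n(a,b)=a\mathcal{F}_{n-1}(a,b)+\mathcal{F}_{n-2}(a,b)$ if $n$ is even, $\mathcal{F}_n(a,b)=b\mathcal{F}_{n-1}(a,b)+\mathcal{F}_{n-2}(a,b)$ if $n$ is odd. The parity function is $\varepsilon(n)=1$ if $n$ is odd and $\varepsilon(n)=0$ if $n$ is even. *)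

theory Defs
  imports "HOL-Analysis.Analysis"
begin

fun bifib :: "real \<Rightarrow> real \<Rightarrow> nat \<Rightarrow> real" where
  "bifib a b 0 = 0"
| "bifib a b (Suc 0) = 1"
| "bifib a b (Suc (Suc n)) =
     (if even (Suc (Suc n)) then a else b) * bifib a b (Suc n) + bifib a b n"

text \<open>
  The sequence with the additional term of index $-1$. The value $1$ there is the one forced
  by the recurrence at index $1$; see \<open>bifib_ext_rec\<close>. Indices below $-1$ are not meaningful.
\<close>

definition bifib_ext :: "real \<Rightarrow> real \<Rightarrow> int \<Rightarrow> real" where
  "bifib_ext a b k = (if k = - 1 then 1 else bifib a b (nat k))"

lemma bifib_ext_of_nat: "bifib_ext a b (int n) = bifib a b n"
  by (simp add: bifib_ext_def)

lemma bifib_ext_rec: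
  assumes "n \<ge> 1"
  shows "bifib_ext a b (int n) =
    (if even n then a else b) * bifib_ext a b (int n - 1) + bifib_ext a b (int n - 2)"
proof (cases "n = 1")
  case True
  then show ?thesis by (simp add: bifib_ext_def)
next
  case False
  define m where "m = n - 2"
  have n: "n = Suc (Suc m)"
    using assms False by (simp add: m_def)
  have "int n - 1 = int (Suc m)" and "int n - 2 = int m"
    by (simp_all add: n)
  moreover have "bifib a b n = (if even n then a else b) * bifib a b (Suc m) + bifib a b m"
    unfolding n by (rule bifib.simps(3))
  ultimately show ?thesis
    by (simp only: bifib_ext_of_nat)
qed

fun bifib_matrix :: "real \<Rightarrow> real \<Rightarrow> nat \<Rightarrow> real^2^2" where
  "bifib_matrix a b 0 = vector [vector [1, 0], vector [0, 1]]"
| "bifib_matrix a b (Suc 0) = vector [vector [b, b / a], vector [1, 0]]"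
| "bifib_matrix a b (Suc (Suc n)) =
     (if even (Suc (Suc n)) then a else b) *\<^sub>R bifib_matrix a b (Suc n) + bifib_matrix a b n"

definition parity :: "nat \<Rightarrow> nat" where
  "parity n = (if odd n then 1 else 0)"

end

theory Submission
  imports Defs
begin

text \<open>
  Both sides satisfy the same second-order recurrence and agree at the indices \<open>0\<close> and \<open>1\<close>.
  The off-diagonal entries are constant multiples of \<open>q\<^sub>n\<close>, so for them the matrix recurrence
  is the recurrence of the sequence itself. On the diagonal the index of \<open>q\<close> is shifted by one,
  so the matrix recurrence at \<open>n\<close> supplies the coefficient \<open>a\<close> exactly where the recurrence
  of the sequence needs \<open>b\<close>, and conversely. The factor \<open>(b / a)\<^bsup>\<epsilon>(n)\<^esup>\<close> repairs this mismatch: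
  \<open>a * (b / a) = b\<close> for even \<open>n\<close> and \<open>b = (b / a) * a\<close> for odd \<open>n\<close>. This is the content of
  \<open>parity_weighted_shifted_recurrence\<close>.
\<close>

lemma vector_2x2_linear_combination:
  fixes c :: real
  shows "c *\<^sub>R vector [vector [x11, x12], vector [x21, x22]]
      + vector [vector [y11, y12], vector [y21, y22]]
    = (vector [vector [c * x11 + y11, c * x12 + y12],
               vector [c * x21 + y21, c * x22 + y22]] :: real^2^2)"
  by (simp add: vec_eq_iff forall_2)

text \<open>
  For \<open>u\<close> with the opposite parity convention, as it arises from \<open>q\<close> by an odd shift of the
  index, multiplying the odd-indexed terms by \<open>b / a\<close> restores the usual convention.
\<close>

lemma parity_weighted_shifted_recurrence:
  fixes a b :: real and u :: "nat \<Rightarrow> real"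
  assumes "a \<noteq> 0"
    and "u (Suc (Suc n)) = (if even n then b else a) * u (Suc n) + u n"
  shows "(if even n then a else b) * ((b / a) ^ parity (Suc n) * u (Suc n))
      + (b / a) ^ parity n * u n
    = (b / a) ^ parity (Suc (Suc n)) * u (Suc (Suc n))"
  using assms by (simp add: parity_def field_simps)

theorem theorem2p2:
  fixes a b :: real and n :: nat
  assumes "a \<noteq> 0" and "b \<noteq> 0"
  shows "bifib_matrix a b n =
    vector [vector [(b / a) ^ parity n * bifib_ext a b (int n + 1), b / a * bifib_ext a b (int n)],
            vector [bifib_ext a b (int n), (b / a) ^ parity n * bifib_ext a b (int n - 1)]]"
proof (induction n rule: induct_nat_012)
  case 0
  show ?case
    by (simp add: bifib_ext_def parity_def)
next
  case 1
  show ?case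
    using assms(1) by (simp add: bifib_ext_def parity_def numeral_2_eq_2)
next
  case (ge2 n)
  let ?q = "bifib_ext a b" and ?c = "if even n then a else b"
  have offdiag: "?c * ?q (int (Suc n)) + ?q (int n) = ?q (int (Suc (Suc n)))"
    using bifib_ext_rec[of "Suc (Suc n)" a b] by simp
  have upper: "?c * ((b / a) ^ parity (Suc n) * ?q (int (Suc n) + 1))
      + (b / a) ^ parity n * ?q (int n + 1)
    = (b / a) ^ parity (Suc (Suc n)) * ?q (int (Suc (Suc n)) + 1)"
    using bifib_ext_rec[of "Suc (Suc (Suc n))" a b]
    by (intro parity_weighted_shifted_recurrence assms(1)) (simp add: algebra_simps)
  \<comment> \<open>For \<open>n = 0\<close> this uses the recurrence at index \<open>1\<close>, hence the value \<open>q\<^sub>-\<^sub>1 = 1\<close>.\<close>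
  have lower: "?c * ((b / a) ^ parity (Suc n) * ?q (int (Suc n) - 1))
      + (b / a) ^ parity n * ?q (int n - 1)
    = (b / a) ^ parity (Suc (Suc n)) * ?q (int (Suc (Suc n)) - 1)"
    using bifib_ext_rec[of "Suc n" a b]
    by (intro parity_weighted_shifted_recurrence assms(1)) (simp add: algebra_simps)
  have scaled: "?c * (b / a * ?q (int (Suc n))) + b / a * ?q (int n)
    = b / a * ?q (int (Suc (Suc n)))"
    unfolding offdiag[symmetric] by (simp add: algebra_simps)
  have "bifib_matrix a b (Suc (Suc n))
    = ?c *\<^sub>R bifib_matrix a b (Suc n) + bifib_matrix a b n"
    by simp
  then show ?case
    unfolding ge2 vector_2x2_linear_combination upper lower scaled offdiag .
qed

end
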